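(* Let $p\ge 1$ and let $0 =: k_0 < k_1 < \cdots < k_p < k_{p+1} := n$ be integers, and set $n_{i+1} := k_{i+1}-k_i$ for $i=0,\dots,p$. If $\varepsilon: \operatorname{Flag}(k_1,\dots,k_p,\mathbb{R}^n) \to \mathsf{S}^2(\mathbb{R}^n)$ is an $\operatorname{SO}_n(\mathbb{R})$-equivariant embedding, then there exist distinct $a_1,\dots,a_{p+1}\in\mathbb{R}$ such that the image of $\varepsilon$ equals $$\Bigl\{ X\in \mathsf{S}^2(\mathbb{R}^n) : \prod_{j=0}^{p} (X - a_{j+1} I_n) = 0,\ \operatorname{tr}(X^i) = \sum_{j=0}^{p} n_{j+1} a_{j+1}^i \text{ for } i=1,\dots,p \Bigr\}.$$
   Context: $\mathsf{S}^2(\mathbb{R}^n)$ is the space of real symmetric $n\times n$ matrices, on which $Q\in\operatorname{SO}_n(\mathbb{R})$ acts by $Q\cdot X := QXQ^{\mathsf T}$. $\operatorname{Flag}(k_1,\dots,k_p,\mathbb{R}^n)$ is the (smooth) manifold of flags $\mathbb{W}_1\subseteq\cdots\subseteq\mathbb{W}_p\subseteq\mathbb{R}^n$ of linear subspaces with $\dim\mathbb{W}_i=k_i$, on which $Q$ acts by $Q\cdot(\mathbb{W}_1\subseteq\cdots\subseteq\mathbb{W}_p) := (Q\mathbb{W}_1\subseteq\cdots\subseteq Q\mathbb{W}_p)$. An embedding $\varepsilon:\mathcal{M}\to\mathbb{V}$ of a $G$-manifold into a $G$-module (a vector space with linear $G$-action) is $G$-equivariant if $\varepsilon(g\cdot x)=g\cdot\varepsilon(x)$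 for all $g\in G$, $x\in\mathcal{M}$. *)

theory Defs
  imports "HOL-Analysis.Analysis"
begin

section \<open>Smooth manifolds given by an atlas of parametrisations\<close>

text \<open>
  \<open>Ck_on m S f\<close> is meant for open sets \<open>S\<close>: all iterated directional derivatives of
  \<open>f\<close> of order at most \<open>m\<close> exist as Frechet derivatives and are continuous on \<open>S\<close>.
\<close>

primrec Ck_on ::
  "nat \<Rightarrow> 'a::euclidean_space set \<Rightarrow> ('a \<Rightarrow> 'b::real_normed_vector) \<Rightarrow> bool" where
  "Ck_on 0 S f \<longleftrightarrow> continuous_on S f"
| "Ck_on (Suc m) S f \<longleftrightarrow>
     (\<exists>f'. (\<forall>x\<in>S. (f has_derivative f' x) (at x)) \<and> (\<forall>v. Ck_on m S (\<lambda>x. f' x v)))"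

text \<open>
  Smoothness on a set that need not be open (below: a linear subspace): locally \<open>f\<close> extends to
  a \<open>C\<^sup>\<infinity>\<close> function on an open subset of the ambient Euclidean space.
\<close>

definition smooth_on :: "'a::euclidean_space set \<Rightarrow> ('a \<Rightarrow> 'b::real_normed_vector) \<Rightarrow> bool" where
  "smooth_on L f \<longleftrightarrow>
     (\<forall>x\<in>L. \<exists>U g. open U \<and> x \<in> U \<and> (\<forall>m. Ck_on m U g) \<and> (\<forall>y\<in>L \<inter> U. g y = f y))"

text \<open>
  A smooth manifold is presented by a set of parametrisations \<open>(L, \<phi>)\<close>, where \<open>\<phi>\<close> maps the linear
  subspace \<open>L\<close> of a fixed Euclidean space bijectively onto a coordinate neighbourhood (so \<open>\<phi>\<close> is
  the inverse of a chart). The manifold topology is the one for which a set is open iff its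
  preimages under all parametrisations are open.
\<close>

type_synonym ('e, 'm) atlas = "('e set \<times> ('e \<Rightarrow> 'm)) set"

definition atlas_topology :: "('e::euclidean_space, 'm) atlas \<Rightarrow> 'm topology" where
  "atlas_topology A = topology (\<lambda>U. U \<subseteq> (\<Union>(L, \<phi>)\<in>A. \<phi> ` L) \<and>
     (\<forall>(L, \<phi>)\<in>A. openin (top_of_set L) {x \<in> L. \<phi> x \<in> U}))"

lemma openin_atlas_topology:
  "openin (atlas_topology A) U \<longleftrightarrow> U \<subseteq> (\<Union>(L, \<phi>)\<in>A. \<phi> ` L) \<and>
     (\<forall>(L, \<phi>)\<in>A. openin (top_of_set L) {x \<in> L. \<phi> x \<in> U})"
proof -
  let ?P = "\<lambda>U. U \<subseteq> (\<Union>(L, \<phi>)\<in>A. \<phi> ` L) \<and>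
     (\<forall>(L, \<phi>)\<in>A. openin (top_of_set L) {x \<in> L. \<phi> x \<in> U})"
  have "istopology ?P"
    unfolding istopology_def
  proof (intro conjI allI impI)
    fix S T assume S: "?P S" and T: "?P T"
    have "openin (top_of_set L) {x \<in> L. \<phi> x \<in> S \<inter> T}" if "(L, \<phi>) \<in> A" for L \<phi>
    proof -
      have "{x \<in> L. \<phi> x \<in> S \<inter> T} = {x \<in> L. \<phi> x \<in> S} \<inter> {x \<in> L. \<phi> x \<in> T}" by blast
      then show ?thesis using S T that by (auto intro: openin_Int)
    qed
    then show "\<forall>(L, \<phi>)\<in>A. openin (top_of_set L) {x \<in> L. \<phi> x \<in> S \<inter> T}" by blast
    show "S \<inter> T \<subseteq> (\<Union>(L, \<phi>)\<in>A. \<phi> ` L)" using S by blast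
  next
    fix K assume K: "\<forall>S\<in>K. ?P S"
    have "openin (top_of_set L) {x \<in> L. \<phi> x \<in> \<Union>K}" if "(L, \<phi>) \<in> A" for L \<phi>
    proof -
      have "{x \<in> L. \<phi> x \<in> \<Union>K} = (\<Union>S\<in>K. {x \<in> L. \<phi> x \<in> S})" by blast
      then show ?thesis using K that by (auto intro!: openin_Union)
    qed
    then show "\<forall>(L, \<phi>)\<in>A. openin (top_of_set L) {x \<in> L. \<phi> x \<in> \<Union>K}" by blast
    show "\<Union>K \<subseteq> (\<Union>(L, \<phi>)\<in>A. \<phi> ` L)" using K by blast
  qed
  then show ?thesis unfolding atlas_topology_def by (simp add: topology_inverse')
qed

lemma topspace_atlas_topology: "topspace (atlas_topology A) = (\<Union>(L, \<phi>)\<in>A. \<phi> ` L)"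
proof
  show "topspace (atlas_topology A) \<subseteq> (\<Union>(L, \<phi>)\<in>A. \<phi> ` L)"
    using openin_topspace[of "atlas_topology A"] unfolding openin_atlas_topology by (rule conjunct1)
  have "openin (top_of_set L) {x \<in> L. \<phi> x \<in> (\<Union>(L, \<phi>)\<in>A. \<phi> ` L)}" if "(L, \<phi>) \<in> A" for L \<phi>
  proof -
    have "{x \<in> L. \<phi> x \<in> (\<Union>(L, \<phi>)\<in>A. \<phi> ` L)} = L" using that by blast
    then show ?thesis by simp
  qed
  then have "openin (atlas_topology A) (\<Union>(L, \<phi>)\<in>A. \<phi> ` L)"
    unfolding openin_atlas_topology by blast
  then show "(\<Union>(L, \<phi>)\<in>A. \<phi> ` L) \<subseteq> topspace (atlas_topology A)"
    by (rule openin_subset)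
qed

definition smooth_map_on_atlas ::
  "('e::euclidean_space, 'm) atlas \<Rightarrow> ('m \<Rightarrow> 'v::real_normed_vector) \<Rightarrow> bool" where
  "smooth_map_on_atlas A f \<longleftrightarrow> (\<forall>(L, \<phi>)\<in>A. smooth_on L (f \<circ> \<phi>))"

definition immersion_on_atlas ::
  "('e::euclidean_space, 'm) atlas \<Rightarrow> ('m \<Rightarrow> 'v::real_normed_vector) \<Rightarrow> bool" where
  "immersion_on_atlas A f \<longleftrightarrow>
     (\<forall>(L, \<phi>)\<in>A. \<forall>x\<in>L. \<exists>D. ((f \<circ> \<phi>) has_derivative D) (at x within L) \<and> inj_on D L)"

definition smooth_embedding ::
  "('e::euclidean_space, 'm) atlas \<Rightarrow> ('m \<Rightarrow> 'v::real_normed_vector) \<Rightarrow> bool" where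
  "smooth_embedding A f \<longleftrightarrow>
     smooth_map_on_atlas A f \<and> immersion_on_atlas A f \<and>
     embedding_map (atlas_topology A) euclidean f"


section \<open>Flag manifolds\<close>

text \<open>
  A flag \<open>W 1 \<subseteq> \<dots> \<subseteq> W p\<close> of type \<open>(k 1, \<dots>, k p)\<close> in \<open>\<real>\<^sup>n\<close> is encoded as a function on all
  natural numbers, padded by \<open>W 0 = {0}\<close> and \<open>W i = UNIV\<close> for \<open>i > p\<close>; this is the
  convention \<open>k 0 = 0\<close>, \<open>k (p + 1) = n\<close> and makes the encoding unique.
\<close>

definition Flag :: "nat \<Rightarrow> (nat \<Rightarrow> nat) \<Rightarrow> (nat \<Rightarrow> (real^'n) set) set" where
  "Flag p k = {W. (\<forall>i\<in>{1..p}. subspace (W i) \<and> dim (W i) = k i) \<and>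
     (\<forall>i\<in>{1..<p}. W i \<subseteq> W (i + 1)) \<and> W 0 = {0} \<and> (\<forall>i>p. W i = UNIV)}"

text \<open>For invertible \<open>Q\<close> the padding is preserved.\<close>

definition flag_act :: "real^'n^'n \<Rightarrow> (nat \<Rightarrow> (real^'n) set) \<Rightarrow> (nat \<Rightarrow> (real^'n) set)" where
  "flag_act Q W = (\<lambda>i. (*v) Q ` W i)"

text \<open>
  The standard big-cell atlas, with one parametrisation centred at every flag \<open>W\<close>.
  The domain \<open>flag_cell p W\<close> is the space of linear maps \<open>N\<close> sending each member of the
  opposite flag \<open>UNIV = (W 0)\<^sup>\<bottom> \<supseteq> (W 1)\<^sup>\<bottom> \<supseteq> \<dots> \<supseteq> (W (p + 1))\<^sup>\<bottom> = {0}\<close> into the next one,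
  i.e. the strictly block lower triangular matrices in an orthonormal basis adapted to \<open>W\<close>, and
  \<open>N \<mapsto> (I + N) \<cdot> W\<close> maps it bijectively onto the flags transversal to that opposite flag.
\<close>

definition flag_cell :: "nat \<Rightarrow> (nat \<Rightarrow> (real^'n) set) \<Rightarrow> (real^'n^'n) set" where
  "flag_cell p W = {N. \<forall>i\<le>p. \<forall>x\<in>(W i)\<^sup>\<bottom>. N *v x \<in> (W (i + 1))\<^sup>\<bottom>}"

definition flag_atlas ::
  "nat \<Rightarrow> (nat \<Rightarrow> nat) \<Rightarrow> (real^'n^'n, nat \<Rightarrow> (real^'n) set) atlas" where
  "flag_atlas p k = {(flag_cell p W, \<lambda>N. flag_act (mat 1 + N) W) | W. W \<in> Flag p k}"

lemma unipotent_inj: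
  assumes W: "W \<in> Flag p k" and N: "N \<in> flag_cell p W"
  shows "inj ((*v) (mat 1 + N))"
proof -
  have "x = 0" if x: "(mat 1 + N) *v x = 0" for x
  proof -
    have eq: "x = - (N *v x)"
      using x by (simp add: matrix_vector_mult_add_rdistrib eq_neg_iff_add_eq_0)
    have "x \<in> (W i)\<^sup>\<bottom>" if "i \<le> p + 1" for i
      using that
    proof (induction i)
      case 0
      have "W 0 = {0}" using W by (simp add: Flag_def)
      then show ?case by simp
    next
      case (Suc i)
      then have "N *v x \<in> (W (i + 1))\<^sup>\<bottom>" using N by (auto simp: flag_cell_def)
      then have "- (N *v x) \<in> (W (i + 1))\<^sup>\<bottom>"
        by (simp add: subspace_neg subspace_orthogonal_comp)
      then show ?case using eq by simp
    qed
    then have "x \<in> (W (p + 1))\<^sup>\<bottom>" by blast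
    moreover have "W (p + 1) = UNIV" using W by (simp add: Flag_def)
    ultimately show ?thesis by simp
  qed
  then show ?thesis
    by (simp add: linear_injective_0 matrix_vector_mul_linear)
qed

lemma flag_act_in_Flag:
  assumes W: "W \<in> Flag p k" and Q: "inj ((*v) (Q :: real^'n^'n))"
  shows "flag_act Q W \<in> Flag p k"
proof -
  have lin: "linear ((*v) Q)" by (rule matrix_vector_mul_linear)
  have "surj ((*v) Q)" using Q lin linear_injective_imp_surjective by blast
  moreover have "dim ((*v) Q ` S) = dim S" for S
    using Q lin by (metis dim_image_eq inj_on_subset subset_UNIV)
  moreover have "subspace ((*v) Q ` S)" if "subspace S" for S
    using lin that by (rule linear_subspace_image)
  ultimately show ?thesis using W
    by (auto simp: Flag_def flag_act_def image_mono)
qed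

lemma topspace_flag_atlas: "topspace (atlas_topology (flag_atlas p k)) = Flag p k"
proof -
  have "flag_act (mat 1 + N) W \<in> Flag p k" if "W \<in> Flag p k" "N \<in> flag_cell p W" for N W
    using flag_act_in_Flag unipotent_inj that by blast
  moreover have "W \<in> (\<lambda>N. flag_act (mat 1 + N) W) ` flag_cell p W" if "W \<in> Flag p k" for W
  proof
    show "W = flag_act (mat 1 + 0) W" by (simp add: flag_act_def)
    show "0 \<in> flag_cell p W"
      by (simp add: flag_cell_def subspace_0 subspace_orthogonal_comp)
  qed
  ultimately show ?thesis
    unfolding topspace_atlas_topology flag_atlas_def by fast
qed


section \<open>Symmetric matrices\<close>

definition sym_mats :: "(real^'n^'n) set" where
  "sym_mats = {X. transpose X = X}"

definition equivariant ::
  "nat \<Rightarrow> (nat \<Rightarrow> nat) \<Rightarrow> ((nat \<Rightarrow> (real^'n) set) \<Rightarrow> real^'n^'n) \<Rightarrow> bool" where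
  "equivariant p k \<epsilon> \<longleftrightarrow>
     (\<forall>Q. rotation_matrix Q \<longrightarrow>
        (\<forall>W\<in>Flag p k. \<epsilon> (flag_act Q W) = Q ** \<epsilon> W ** transpose Q))"

text \<open>
  The class operations \<open>*\<close> and \<open>^\<close> on \<open>real^'n^'n\<close> act componentwise, so powers and
  products of matrices are defined from the matrix product \<open>**\<close>.
\<close>

primrec mat_power :: "real^'n^'n \<Rightarrow> nat \<Rightarrow> real^'n^'n" where
  "mat_power X 0 = mat 1"
| "mat_power X (Suc i) = mat_power X i ** X"

text \<open>\<open>mat_prod M m = M 0 ** M 1 ** \<dots> ** M (m - 1)\<close>\<close>

primrec mat_prod :: "(nat \<Rightarrow> real^'n^'n) \<Rightarrow> nat \<Rightarrow> real^'n^'n" where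
  "mat_prod M 0 = mat 1"
| "mat_prod M (Suc m) = mat_prod M m ** M m"

end

theory Submission
  imports Defs
begin

text \<open>
  The image of an equivariant map on a homogeneous space is a single orbit, so two orbits have to
  be identified.

  Rotations act transitively on flags (\<open>rotations_transitive_on_flags\<close>). Hence the image of
  \<open>\<epsilon>\<close> is the conjugacy class, under rotations, of \<open>X\<^sub>0 = \<epsilon> F\<^sub>0\<close> for one coordinate flag \<open>F\<^sub>0\<close>. On the
  other side, for distinct \<open>a\<^sub>1, \<dots>, a\<^sub>p\<^sub>+\<^sub>1\<close> the equations in the theorem describe the symmetric matrices
  with eigenvalue \<open>a\<^sub>j\<close> of multiplicity \<open>n\<^sub>j\<close>: the product equation says that \<open>X\<close> is
  diagonalisable with eigenvalues among the \<open>a\<^sub>j\<close>, and the trace equations together with the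
  equation for the size \<open>n\<close> form a Vandermonde system for the multiplicities. Such matrices also
  form a single orbit (\<open>spectral_set_eq_orbit\<close>). Both transitivity statements rest on
  \<open>adapted_rotation\<close>, which builds a rotation whose columns lie in prescribed orthogonal subspaces.

  It remains to see that \<open>X\<^sub>0\<close> satisfies the equations for some distinct \<open>a\<^sub>j\<close>
  (\<open>spectral_set_of_std_flag\<close>). The matrix \<open>X\<^sub>0\<close> commutes with the stabiliser of \<open>F\<^sub>0\<close>. If \<open>n \<ge> 3\<close>, the sign
  matrices in the stabiliser force \<open>X\<^sub>0\<close> to be diagonal, and the signed transpositions within a
  block force the diagonal to be constant on blocks. Equal values on two blocks would allow
  these blocks to be mixed without changing \<open>X\<^sub>0\<close>, contrary to injectivity of \<open>\<epsilon>\<close>. If \<open>n = 2\<close>, the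
  stabiliser is \<open>{I, - I}\<close> and gives no information, and \<open>X\<^sub>0\<close> may be any symmetric matrix that is not
  scalar; but such a matrix has two different eigenvalues, which is all that is needed.
\<close>

section \<open>Diagonal matrices and conjugation\<close>

definition diagm :: "('n \<Rightarrow> real) \<Rightarrow> real^'n^'n" where
  "diagm d = (\<chi> i j. if i = j then d i else 0)"

lemma diagm_nth: "diagm d $ i $ j = (if i = j then d i else 0)"
  by (simp add: diagm_def)

lemma diagm_mult_left: "(diagm d ** A) $ i $ j = d i * A $ i $ j"
  by (simp add: matrix_matrix_mult_def diagm_nth if_distrib[of "\<lambda>x. x * _"] cong: if_cong)

lemma diagm_mult_right: "(A ** diagm d) $ i $ j = A $ i $ j * d j"
  by (simp add: matrix_matrix_mult_def diagm_nth if_distrib[of "\<lambda>x. _ * x"] cong: if_cong)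

lemma diagm_mult: "diagm d ** diagm e = diagm (\<lambda>i. d i * e i)"
  by (simp add: vec_eq_iff diagm_mult_left diagm_nth)

lemma transpose_diagm: "transpose (diagm d) = diagm d"
  by (simp add: vec_eq_iff transpose_def diagm_nth)

lemma diagm_one: "diagm (\<lambda>_. 1) = mat 1"
  by (simp add: vec_eq_iff mat_def diagm_nth)

lemma diagm_shift: "diagm d - t *\<^sub>R mat 1 = diagm (\<lambda>i. d i - t)"
  by (simp add: vec_eq_iff mat_def diagm_nth)

lemma trace_diagm: "trace (diagm d) = (\<Sum>i\<in>UNIV. d i)"
  by (simp add: trace_def diagm_nth)

lemma det_diagm: "det (diagm d) = (\<Prod>i\<in>UNIV. d i)"
  by (subst det_diagonal) (simp_all add: diagm_nth)

lemma mat_power_diagm: "mat_power (diagm d) i = diagm (\<lambda>l. d l ^ i)"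
  by (induction i) (simp_all add: diagm_one diagm_mult mult.commute)

lemma mat_prod_diagm: "mat_prod (\<lambda>j. diagm (d j)) m = diagm (\<lambda>l. \<Prod>j<m. d j l)"
  by (induction m) (simp_all add: diagm_one diagm_mult)

lemma conj_mult:
  assumes "orthogonal_matrix Q"
  shows "(Q ** A ** transpose Q) ** (Q ** B ** transpose Q) = Q ** (A ** B) ** transpose (Q :: real^'n^'n)"
proof -
  have "(Q ** A ** transpose Q) ** (Q ** B ** transpose Q)
      = Q ** A ** (transpose Q ** Q) ** B ** transpose Q"
    by (simp add: matrix_mul_assoc)
  also have "\<dots> = Q ** A ** B ** transpose Q"
    using assms by (simp add: orthogonal_matrix_def)
  finally show ?thesis
    by (simp add: matrix_mul_assoc)
qed

lemma conj_mat_1: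
  assumes "orthogonal_matrix Q"
  shows "Q ** mat 1 ** transpose Q = mat 1"
  using assms by (simp add: orthogonal_matrix_def)

lemma mat_power_conj:
  assumes "orthogonal_matrix (Q :: real^'n^'n)"
  shows "mat_power (Q ** X ** transpose Q) i = Q ** mat_power X i ** transpose Q"
  using assms by (induction i) (simp_all add: conj_mat_1 conj_mult del: matrix_mul_rid)

lemma mat_prod_conj:
  assumes "orthogonal_matrix (Q :: real^'n^'n)"
  shows "mat_prod (\<lambda>j. Q ** M j ** transpose Q) m = Q ** mat_prod M m ** transpose Q"
  using assms by (induction m) (simp_all add: conj_mat_1 conj_mult del: matrix_mul_rid)

lemma trace_conj:
  assumes "orthogonal_matrix (Q :: real^'n^'n)"
  shows "trace (Q ** X ** transpose Q) = trace X"
proof -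
  have "trace (Q ** X ** transpose Q) = trace (transpose Q ** (Q ** X))"
    by (rule trace_mul_sym)
  then show ?thesis
    using assms by (simp add: matrix_mul_assoc orthogonal_matrix_def)
qed

lemma matrix_diff_ldistrib: "A ** (B - C) = A ** B - A ** (C :: real^'n^'m)"
  by (simp add: vec_eq_iff matrix_matrix_mult_def sum_subtractf algebra_simps)

lemma matrix_diff_rdistrib: "(A - B) ** C = A ** C - B ** (C :: real^'n^'m)"
  by (simp add: vec_eq_iff matrix_matrix_mult_def sum_subtractf algebra_simps)

lemma conj_shift:
  assumes "orthogonal_matrix (Q :: real^'n^'n)"
  shows "Q ** X ** transpose Q - t *\<^sub>R mat 1 = Q ** (X - t *\<^sub>R mat 1) ** transpose Q"
proof -
  have "Q ** (X - t *\<^sub>R mat 1) = Q ** X - t *\<^sub>R Q"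
    by (simp add: matrix_diff_ldistrib matrix_scalar_ac scalar_matrix_assoc[symmetric])
  then have "Q ** (X - t *\<^sub>R mat 1) ** transpose Q = Q ** X ** transpose Q - t *\<^sub>R (Q ** transpose Q)"
    by (simp add: matrix_diff_rdistrib scalar_matrix_assoc)
  then show ?thesis
    using assms by (simp add: orthogonal_matrix_def)
qed

lemma conj_eq_iff:
  assumes "orthogonal_matrix (Q :: real^'n^'n)"
  shows "X = Q ** Y ** transpose Q \<longleftrightarrow> X ** Q = Q ** Y"
proof
  assume "X = Q ** Y ** transpose Q"
  then have "X ** Q = Q ** Y ** (transpose Q ** Q)" by (simp add: matrix_mul_assoc)
  then show "X ** Q = Q ** Y" using assms by (simp add: orthogonal_matrix_def)
next
  assume "X ** Q = Q ** Y"
  then have "Q ** Y ** transpose Q = X ** (Q ** transpose Q)" by (simp add: matrix_mul_assoc)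
  then show "X = Q ** Y ** transpose Q" using assms by (simp add: orthogonal_matrix_def)
qed

section \<open>Rotations adapted to an orthogonal family of subspaces\<close>

lemma rotation_orthogonal: "rotation_matrix Q \<Longrightarrow> orthogonal_matrix Q"
  by (simp add: rotation_matrix_def)

lemma rotation_matrix_mul:
  "rotation_matrix (P :: real^'n^'n) \<Longrightarrow> rotation_matrix Q \<Longrightarrow> rotation_matrix (P ** Q)"
  by (simp add: rotation_matrix_def orthogonal_matrix_mul det_mul)

lemma rotation_matrix_transpose:
  "rotation_matrix (Q :: real^'n^'n) \<Longrightarrow> rotation_matrix (transpose Q)"
  by (simp add: rotation_matrix_def orthogonal_matrix_def)

lemma orthogonal_matrix_inj: "orthogonal_matrix (Q :: real^'n^'n) \<Longrightarrow> inj ((*v) Q)"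
  by (rule inj_on_inverseI[of _ "(*v) (transpose Q)"])
    (simp add: matrix_vector_mul_assoc orthogonal_matrix_def)

lemma rotation_matrix_diagm_signs:
  assumes "\<And>l :: 'n::finite. s l * s l = 1" and "(\<Prod>l\<in>UNIV. s l) = 1"
  shows "rotation_matrix (diagm s)"
  using assms
  by (simp add: rotation_matrix_def orthogonal_matrix transpose_diagm diagm_mult det_diagm diagm_one)

text \<open>
  This is the common source of transitivity, on flags as well as on matrices with a given
  spectrum: orthonormal bases of the \<open>V j\<close>, distributed over the columns of colour \<open>j\<close>, form an
  orthogonal matrix. Its determinant is \<open>1\<close> or \<open>- 1\<close>, and in the second case one column can be
  negated, because the \<open>V j\<close> are closed under negation.
\<close>

lemma adapted_rotation:
  fixes c :: "'n::finite \<Rightarrow> 'j" and V :: "'j \<Rightarrow> (real^'n) set"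
  assumes sub: "\<And>l. subspace (V (c l))"
    and dim: "\<And>l. dim (V (c l)) = card {l'. c l' = c l}"
    and orth: "\<And>l l' x y. c l \<noteq> c l' \<Longrightarrow> x \<in> V (c l) \<Longrightarrow> y \<in> V (c l') \<Longrightarrow> orthogonal x y"
  obtains Q where "rotation_matrix Q" and "\<And>l. column l Q \<in> V (c l)"
proof -
  define frame where "frame j f \<longleftrightarrow> (\<forall>l. c l = j \<longrightarrow> f l \<in> V j \<and> norm (f l) = 1 \<and>
      (\<forall>l'. c l' = j \<and> l \<noteq> l' \<longrightarrow> orthogonal (f l) (f l')))" for j f
  have "\<exists>f. frame j f" if "j \<in> range c" for j
  proof -
    obtain l where j: "j = c l" using \<open>j \<in> range c\<close> by blast
    obtain B where B: "B \<subseteq> V j" "pairwise orthogonal B" "\<And>x. x \<in> B \<Longrightarrow> norm x = 1"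
      "independent B" "card B = dim (V j)"
      using orthonormal_basis_subspace[OF sub[of l]] j by metis
    have "card {l'. c l' = j} = card B" using dim[of l] B(5) j by simp
    moreover have "finite B" using B(4) independent_imp_finite by blast
    ultimately obtain f where f: "bij_betw f {l'. c l' = j} B"
      using finite_same_card_bij[of "{l'. c l' = j}" B] by auto
    have "f l' \<in> B" if "c l' = j" for l'
      using f that by (auto simp: bij_betw_def)
    moreover have "orthogonal (f l') (f l'')" if "c l' = j" "c l'' = j" "l' \<noteq> l''" for l' l''
      using f that B(2) by (auto simp: bij_betw_def inj_on_def pairwise_def)
    ultimately show ?thesis using B unfolding frame_def by (intro exI[of _ f]) blast
  qed
  then obtain f where "\<And>j. j \<in> range c \<Longrightarrow> frame j (f j)" by metis
  then have f: "frame (c l) (f (c l))" for l by blast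
  define b where "b l = f (c l) l" for l
  have bV: "b l \<in> V (c l)" and bn: "norm (b l) = 1" for l
    using f[of l] by (auto simp: b_def frame_def)
  have bo: "orthogonal (b l) (b l')" if "l \<noteq> l'" for l l'
  proof (cases "c l = c l'")
    case True
    then show ?thesis using f[of l] that by (auto simp: b_def frame_def)
  next
    case False
    then show ?thesis using orth bV by blast
  qed
  define Q where "Q = (\<chi> r l. b l $ r)"
  have col: "column l Q = b l" for l
    by (simp add: Q_def column_def vec_eq_iff)
  have oQ: "orthogonal_matrix Q"
    unfolding orthogonal_matrix_orthonormal_columns using bn bo by (simp add: col)
  \<comment> \<open>The index \<open>undefined\<close> stands for an arbitrary column.\<close>
  define s where "s l = (if l = undefined then det Q else 1)" for l :: 'n
  have dQ: "det Q * det Q = 1" using det_orthogonal_matrix[OF oQ] by auto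
  have ps: "(\<Prod>l\<in>UNIV. s l) = det Q"
    by (simp add: s_def)
  have "s l * s l = 1" for l using dQ by (simp add: s_def)
  then have "orthogonal_matrix (diagm s)"
    by (simp add: orthogonal_matrix transpose_diagm diagm_mult diagm_one)
  then have "rotation_matrix (Q ** diagm s)"
    using oQ dQ by (simp add: rotation_matrix_def orthogonal_matrix_mul det_mul det_diagm ps)
  moreover have "column l (Q ** diagm s) = s l *\<^sub>R b l" for l
    by (simp add: vec_eq_iff column_def diagm_mult_right Q_def)
  then have "column l (Q ** diagm s) \<in> V (c l)" for l
    using bV sub by (simp add: subspace_scale)
  ultimately show ?thesis using that by blast
qed

text \<open>
  The permutation matrix exchanging two different coordinates has determinant \<open>- 1\<close>. A change of
  signs turns it into a rotation that still exchanges the two coordinate lines and has the same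
  effect on diagonal matrices by conjugation. Its later uses rest on the positions of the entries alone, so only
  \<open>s l \<noteq> 0\<close> is recorded of the signs.
\<close>

lemma rotation_signed_transposition:
  fixes i j :: "'n::finite"
  obtains Q :: "real^'n^'n" and s
    where "rotation_matrix Q" and "\<And>l. s l \<noteq> 0"
      and "Q = (\<chi> r l. if r = Transposition.transpose i j l then s l else 0)"
proof -
  let ?\<pi> = "Transposition.transpose i j"
  define V where "V l = span {axis (?\<pi> l) 1 :: real^'n}" for l
  obtain Q :: "real^'n^'n" where Q: "rotation_matrix Q" "\<And>l. column l Q \<in> V l"
  proof (rule adapted_rotation[of V id])
    show "subspace (V (id l))" for l by (simp add: V_def)
    show "dim (V (id l)) = card {l'. id l' = id l}" for l
      by (simp add: V_def)
    show "orthogonal x y" if ne: "id l \<noteq> id l'" and xy: "x \<in> V (id l)" "y \<in> V (id l')" for l l' x y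
    proof -
      have "?\<pi> l \<noteq> ?\<pi> l'" using ne by (metis id_apply transpose_involutory)
      moreover obtain t u where "x = t *\<^sub>R axis (?\<pi> l) 1" "y = u *\<^sub>R axis (?\<pi> l') 1"
        using xy by (auto simp: V_def span_singleton)
      ultimately show ?thesis by (simp add: orthogonal_def inner_axis_axis)
    qed
  qed simp
  have "\<exists>t. column l Q = t *\<^sub>R axis (?\<pi> l) 1" for l
    using Q(2)[of l] by (auto simp: V_def span_singleton)
  then obtain s where s: "\<And>l. column l Q = s l *\<^sub>R axis (?\<pi> l) 1" by metis
  show ?thesis
  proof
    show "rotation_matrix Q" by fact
    show "s l \<noteq> 0" for l
    proof -
      have "norm (column l Q) = 1"
        using rotation_orthogonal[OF Q(1)] by (simp add: orthogonal_matrix_orthonormal_columns)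
      then show ?thesis using s[of l] by auto
    qed
    have "Q $ r $ l = (if r = ?\<pi> l then s l else 0)" for r l
    proof -
      have "Q $ r $ l = column l Q $ r" by (simp add: column_def)
      then show ?thesis by (simp add: s axis_def)
    qed
    then show "Q = (\<chi> r l. if r = ?\<pi> l then s l else 0)"
      by (simp add: vec_eq_iff)
  qed
qed

section \<open>Colourings of a finite index type\<close>

text \<open>
  Colours serve as names of blocks: a decomposition of the coordinates into blocks of sizes \<open>m j\<close>
  is a function to \<open>J\<close> with fibres of these sizes. It is read off from a bijection of the index
  type with the disjoint union of the intervals \<open>{..<m j}\<close>.
\<close>

lemma colouring_exists:
  fixes J :: "'j set" and m :: "'j \<Rightarrow> nat"
  assumes "finite J" and "(\<Sum>j\<in>J. m j) = CARD('n::finite)"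
  shows "\<exists>c :: 'n \<Rightarrow> 'j. range c \<subseteq> J \<and> (\<forall>j\<in>J. card {l. c l = j} = m j)"
proof -
  let ?S = "SIGMA j:J. {..<m j}"
  have "card ?S = CARD('n)" using assms by simp
  moreover have "finite ?S" using assms by simp
  ultimately obtain g :: "'n \<Rightarrow> 'j \<times> nat" where g: "bij_betw g UNIV ?S"
    by (metis finite finite_same_card_bij)
  show ?thesis
  proof (intro exI[of _ "fst \<circ> g"] conjI ballI)
    show "range (fst \<circ> g) \<subseteq> J"
      using bij_betwE[OF g] by fastforce
    show "card {l. (fst \<circ> g) l = j} = m j" if "j \<in> J" for j
    proof -
      have "g ` {l. (fst \<circ> g) l = j} = {j} \<times> {..<m j}"
      proof
        have "snd (g l) < m (fst (g l))" for l
          using bij_betwE[OF g, rule_format, of l] by (cases "g l") auto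
        then show "g ` {l. (fst \<circ> g) l = j} \<subseteq> {j} \<times> {..<m j}"
          by (auto simp: image_subset_iff mem_Times_iff)
        show "{j} \<times> {..<m j} \<subseteq> g ` {l. (fst \<circ> g) l = j}"
        proof clarify
          fix t assume "t < m j"
          then have "(j, t) \<in> range g" using bij_betw_imp_surj_on[OF g] that by auto
          then show "(j, t) \<in> g ` {l. (fst \<circ> g) l = j}"
            by (metis (mono_tags, lifting) comp_apply fst_conv image_iff mem_Collect_eq)
        qed
      qed
      moreover have "inj_on g {l. (fst \<circ> g) l = j}"
        using g by (meson bij_betw_def inj_on_subset subset_UNIV)
      ultimately show ?thesis
        by (metis card_image card_cartesian_product_singleton card_lessThan)
    qed
  qed
qed

lemma sum_colouring:
  fixes f :: "'j \<Rightarrow> 'b::comm_semiring_1" and c :: "'n::finite \<Rightarrow> 'j"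
  assumes "finite J" and "range c \<subseteq> J"
  shows "(\<Sum>l\<in>UNIV. f (c l)) = (\<Sum>j\<in>J. of_nat (card {l. c l = j}) * f j)"
proof -
  have "(\<Sum>l\<in>UNIV. f (c l)) = (\<Sum>j\<in>J. \<Sum>l\<in>{l\<in>UNIV. c l = j}. f (c l))"
    by (rule sum.group[symmetric]) (use assms in auto)
  then show ?thesis by simp
qed

section \<open>Power sums at distinct nodes\<close>

text \<open>
  Invertibility of the Vandermonde matrix. By linearity \<open>\<Sum>j\<in>J. d j * poly q (a j) = 0\<close> for every
  polynomial \<open>q\<close> of degree less than \<open>card J\<close>; the unnormalised Lagrange polynomial that vanishes
  at all nodes except \<open>a j0\<close> isolates the term of \<open>j0\<close>.
\<close>

lemma power_sums_determine_weights:
  fixes a d :: "'j \<Rightarrow> real"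
  assumes fin: "finite J" and inj: "inj_on a J"
    and eq: "\<And>i. i < card J \<Longrightarrow> (\<Sum>j\<in>J. d j * a j ^ i) = 0"
    and j0: "j0 \<in> J"
  shows "d j0 = 0"
proof -
  define q where "q = (\<Prod>j\<in>J - {j0}. [:- a j, 1:])"
  have "degree q = card (J - {j0})"
    unfolding q_def by (subst degree_prod_sum_eq) auto
  then have deg: "degree q < card J"
    using fin j0 by (metis card_Diff1_less)
  have "(\<Sum>j\<in>J. d j * poly q (a j)) = (\<Sum>j\<in>J. \<Sum>i\<le>degree q. coeff q i * (d j * a j ^ i))"
    by (simp add: poly_altdef sum_distrib_left algebra_simps)
  also have "\<dots> = (\<Sum>i\<le>degree q. coeff q i * (\<Sum>j\<in>J. d j * a j ^ i))"
    by (subst sum.swap) (simp add: sum_distrib_left)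
  also have "\<dots> = 0"
    using eq deg by simp
  finally have "(\<Sum>j\<in>J. d j * poly q (a j)) = 0" .
  moreover have "poly q (a j) = 0" if "j \<in> J - {j0}" for j
    using that fin by (auto simp: q_def poly_prod prod_zero_iff)
  ultimately have "d j0 * poly q (a j0) = 0"
    using fin j0 by (simp add: sum.remove)
  moreover have "poly q (a j0) \<noteq> 0"
    using fin inj j0 by (auto simp: q_def poly_prod prod_zero_iff inj_on_def)
  ultimately show ?thesis by simp
qed

section \<open>Transitivity of rotations on flags\<close>

text \<open>
  A colouring describes a coordinate flag: colour \<open>j\<close> marks the coordinates by which the \<open>j\<close>-th
  member of the flag exceeds the previous one.
\<close>

definition flag_colouring :: "nat \<Rightarrow> (nat \<Rightarrow> nat) \<Rightarrow> ('n::finite \<Rightarrow> nat) \<Rightarrow> bool" where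
  "flag_colouring p k c \<longleftrightarrow> range c \<subseteq> {1..p + 1} \<and>
     (\<forall>j\<in>{1..p + 1}. card {l. c l = j} = k j - k (j - 1))"

definition std_flag :: "('n::finite \<Rightarrow> nat) \<Rightarrow> nat \<Rightarrow> (real^'n) set" where
  "std_flag c i = {x. \<forall>l. i < c l \<longrightarrow> x $ l = 0}"

lemma flag_colouring_range: "flag_colouring p k c \<Longrightarrow> 1 \<le> c l \<and> c l \<le> p + 1"
  unfolding flag_colouring_def by (metis atLeastAtMost_iff rangeI subsetD)

lemma flag_colouring_exists:
  assumes "k 0 = 0" and "\<And>i. i \<le> p \<Longrightarrow> k i \<le> k (i + 1)" and "k (p + 1) = CARD('n::finite)"
  shows "\<exists>c :: 'n \<Rightarrow> nat. flag_colouring p k c"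
proof -
  have "(\<Sum>j=1..i. k j - k (j - 1)) = k i" if "i \<le> p + 1" for i
    using that by (induction i) (use assms(1,2) in force)+
  then have "(\<Sum>j=1..p + 1. k j - k (j - 1)) = CARD('n)" using assms(3) by (metis order_refl)
  then show ?thesis
    unfolding flag_colouring_def by (intro colouring_exists) auto
qed

lemma card_colours_le:
  assumes c: "flag_colouring p k c" and "k 0 = 0" and mono: "\<And>i. i \<le> p \<Longrightarrow> k i \<le> k (i + 1)"
    and "i \<le> p + 1"
  shows "card {l. c l \<le> i} = k i"
  using \<open>i \<le> p + 1\<close>
proof (induction i)
  case 0
  have "c l \<noteq> 0" for l
    using flag_colouring_range[OF c, of l] by simp
  then show ?case using \<open>k 0 = 0\<close> by simp
next
  case (Suc i)
  have "{l. c l \<le> Suc i} = {l. c l \<le> i} \<union> {l. c l = Suc i}" by auto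
  moreover have "card ({l. c l \<le> i} \<union> {l. c l = Suc i}) = card {l. c l \<le> i} + card {l. c l = Suc i}"
    by (rule card_Un_disjoint) auto
  moreover have "card {l. c l = Suc i} = k (Suc i) - k i"
    using c Suc.prems by (simp add: flag_colouring_def)
  ultimately show ?case using Suc mono[of i] by simp
qed

lemma subspace_std_flag: "subspace (std_flag c i)"
  by (simp add: std_flag_def subspace_def)

lemma dim_std_flag: "dim (std_flag c i) = card {l. c l \<le> i}"
proof -
  have "std_flag c i = {x. \<forall>l. l \<notin> {l. c l \<le> i} \<longrightarrow> x $ l = 0}"
    by (auto simp: std_flag_def)
  then show ?thesis
    using dim_substandard_cart[where ?'a = real, of "{l. c l \<le> i}"] by (simp add: dim_vec_eq)
qed

lemma std_flag_in_Flag: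
  fixes c :: "'n::finite \<Rightarrow> nat"
  assumes c: "flag_colouring p k c" and "k 0 = 0" and "\<And>i. i \<le> p \<Longrightarrow> k i \<le> k (i + 1)"
  shows "std_flag c \<in> Flag p k"
proof -
  have r: "1 \<le> c l" "c l \<le> p + 1" for l
    using flag_colouring_range[OF c] by simp_all
  have "std_flag c 0 = {0}"
    using r(1) by (auto simp: std_flag_def vec_eq_iff Suc_le_eq)
  moreover have "std_flag c i = UNIV" if "i > p" for i
  proof -
    have "\<not> i < c l" for l using r(2)[of l] that by simp
    then show ?thesis by (simp add: std_flag_def)
  qed
  moreover have "dim (std_flag c i) = k i" if "i \<in> {1..p}" for i
    using that card_colours_le[OF assms, of i] by (simp add: dim_std_flag)
  moreover have "std_flag c i \<subseteq> std_flag c (i + 1)" for i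
    by (auto simp: std_flag_def)
  ultimately show ?thesis
    by (simp add: Flag_def subspace_std_flag)
qed

text \<open>
  Flags of the same type are determined by inclusions, since the dimensions agree. Hence to
  compute the image of a flag under a rotation it suffices to control where vectors go.
\<close>

lemma Flag_eqI:
  assumes W: "W \<in> Flag p k" and W': "W' \<in> Flag p k" and sub: "\<And>i. W i \<subseteq> W' i"
  shows "W = W'"
proof
  fix i
  consider "i = 0" | "i \<in> {1..p}" | "i > p" by fastforce
  then show "W i = W' i"
  proof cases
    case 2
    then show ?thesis
      using W W' by (intro subspace_dim_equal sub) (auto simp: Flag_def)
  qed (use W W' in \<open>auto simp: Flag_def\<close>)
qed

lemma flag_subspace:
  assumes "W \<in> Flag p k"
  shows "subspace (W i)"
proof -
  consider "i = 0" | "i \<in> {1..p}" | "i > p" by fastforce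
  then show ?thesis using assms by cases (auto simp: Flag_def)
qed

lemma flag_subset:
  assumes W: "W \<in> Flag p k"
  shows "i \<le> j \<Longrightarrow> W i \<subseteq> W j"
proof (rule lift_Suc_mono_le[of W])
  fix i
  have "0 \<in> W (Suc 0)"
    using flag_subspace[OF W] by (rule subspace_0)
  then have "W 0 \<subseteq> W (Suc 0)"
    using W by (simp add: Flag_def)
  moreover have "W i \<subseteq> W (Suc i)" if "i \<in> {1..<p}"
    using W that by (simp add: Flag_def)
  moreover have "W (Suc i) = UNIV" if "i \<ge> p"
    using W that by (simp add: Flag_def)
  ultimately show "W i \<subseteq> W (Suc i)"
    by (cases "i = 0"; cases "i \<ge> p") auto
qed

lemma flag_dim:
  assumes "(W :: nat \<Rightarrow> (real^'n) set) \<in> Flag p k" "k 0 = 0" "k (p + 1) = CARD('n)" "i \<le> p + 1"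
  shows "dim (W i) = k i"
proof -
  consider "i = 0" | "i \<in> {1..p}" | "i = p + 1" using assms(4) by fastforce
  then show ?thesis using assms by cases (auto simp: Flag_def)
qed

text \<open>
  The successive orthogonal differences \<open>W j \<inter> (W (j - 1))\<^sup>\<bottom>\<close> of a flag are pairwise orthogonal
  and have dimension \<open>k j - k (j - 1)\<close>, so that a rotation adapted to them carries the standard
  flag into \<open>W\<close>.
\<close>

lemma rotations_transitive_on_flags:
  fixes W :: "nat \<Rightarrow> (real^'n) set"
  assumes W: "W \<in> Flag p k" and c: "flag_colouring p k c"
    and k0: "k 0 = 0" and mono: "\<And>i. i \<le> p \<Longrightarrow> k i \<le> k (i + 1)" and kn: "k (p + 1) = CARD('n)"
  obtains Q where "rotation_matrix Q" and "flag_act Q (std_flag c) = W"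
proof -
  have r: "1 \<le> c l" "c l \<le> p + 1" for l
    using flag_colouring_range[OF c] by simp_all
  define V where "V j = {y \<in> W j. \<forall>x\<in>W (j - 1). orthogonal x y}" for j
  obtain Q where Q: "rotation_matrix Q" "\<And>l. column l Q \<in> V (c l)"
  proof (rule adapted_rotation[of V c])
    fix l
    have "{y. \<forall>x\<in>W (c l - 1). orthogonal x y} = (W (c l - 1))\<^sup>\<bottom>"
      by (auto simp: orthogonal_comp_def)
    then have "V (c l) = W (c l) \<inter> (W (c l - 1))\<^sup>\<bottom>"
      by (auto simp: V_def)
    then show "subspace (V (c l))"
      by (simp add: flag_subspace[OF W] subspace_inter subspace_orthogonal_comp)
    have "dim (V (c l)) + dim (W (c l - 1)) = dim (W (c l))"
      unfolding V_def
      by (intro dim_subspace_orthogonal_to_vectors flag_subspace[OF W] flag_subset[OF W]) simp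
    moreover have "dim (W (c l - 1)) = k (c l - 1)" "dim (W (c l)) = k (c l)"
      using r[of l] by (auto intro!: flag_dim[OF W k0 kn])
    ultimately show "dim (V (c l)) = card {l'. c l' = c l}"
      using c r[of l] by (simp add: flag_colouring_def)
  next
    have *: "orthogonal x y" if "c l < c l'" "x \<in> V (c l)" "y \<in> V (c l')" for l l' x y
    proof -
      have "x \<in> W (c l' - 1)"
        using that(2) flag_subset[OF W, of "c l" "c l' - 1"] \<open>c l < c l'\<close> by (force simp: V_def)
      then show ?thesis using that(3) by (simp add: V_def)
    qed
    show "orthogonal x y" if "c l \<noteq> c l'" "x \<in> V (c l)" "y \<in> V (c l')" for l l' x y
      using *[of l l' x y] *[of l' l y x] that by (metis nat_neq_iff orthogonal_commute)
  qed blast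
  have "flag_act Q (std_flag c) = W"
  proof (rule Flag_eqI)
    show "flag_act Q (std_flag c) \<in> Flag p k"
      by (intro flag_act_in_Flag std_flag_in_Flag[OF c k0 mono] orthogonal_matrix_inj
          rotation_orthogonal Q(1))
    show "W \<in> Flag p k" by fact
    have "Q *v x \<in> W i" if x: "x \<in> std_flag c i" for x i
      unfolding matrix_mult_sum
    proof (rule subspace_sum[OF flag_subspace[OF W]])
      fix l
      have "column l Q \<in> W i" if "c l \<le> i"
        using Q(2)[of l] flag_subset[OF W that] by (auto simp: V_def)
      then show "x $ l *s column l Q \<in> W i"
        using x by (cases "c l \<le> i")
          (auto simp: std_flag_def scalar_mult_eq_scaleR intro: subspace_scale subspace_0 flag_subspace[OF W])
    qed
    then show "flag_act Q (std_flag c) i \<subseteq> W i" for i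
      by (auto simp: flag_act_def)
  qed
  then show ?thesis using that Q(1) by blast
qed

section \<open>Matrices with prescribed spectrum\<close>

text \<open>
  For distinct \<open>a j\<close> these are the symmetric matrices with eigenvalues \<open>a 1, \<dots>, a (p + 1)\<close> of
  multiplicities \<open>m 1, \<dots>, m (p + 1)\<close>, provided that the \<open>m j\<close> add up to the size of the matrix;
  the lemmas below establish this.
\<close>

definition spectral_set :: "nat \<Rightarrow> (nat \<Rightarrow> real) \<Rightarrow> (nat \<Rightarrow> nat) \<Rightarrow> (real^'n^'n) set" where
  "spectral_set p a m = {X \<in> sym_mats.
     mat_prod (\<lambda>j. X - a (j + 1) *\<^sub>R mat 1) (p + 1) = 0 \<and>
     (\<forall>i\<in>{1..p}. trace (mat_power X i) = (\<Sum>j=0..p. real (m (j + 1)) * a (j + 1) ^ i))}"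

lemma trace_power_diagm_colouring:
  fixes c :: "'n::finite \<Rightarrow> nat"
  assumes "range c \<subseteq> {1..p + 1}"
  shows "trace (mat_power (diagm (a \<circ> c)) i)
    = (\<Sum>j=0..p. real (card {l. c l = j + 1}) * a (j + 1) ^ i)"
proof -
  have "trace (mat_power (diagm (a \<circ> c)) i) = (\<Sum>j=1..p + 1. real (card {l. c l = j}) * a j ^ i)"
    using sum_colouring[OF finite_atLeastAtMost assms, of "\<lambda>j. a j ^ i"]
    by (simp add: mat_power_diagm trace_diagm)
  also have "\<dots> = (\<Sum>j=0..p. real (card {l. c l = j + 1}) * a (j + 1) ^ i)"
    using sum.shift_bounds_cl_nat_ivl[of "\<lambda>j. real (card {l. c l = j}) * a j ^ i" 0 1 p] by simp
  finally show ?thesis .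
qed

lemma diagm_in_spectral_set:
  assumes r: "range c \<subseteq> {1..p + 1}" and m: "\<And>j. j \<in> {1..p + 1} \<Longrightarrow> card {l. c l = j} = m j"
  shows "diagm (a \<circ> c) \<in> spectral_set p a m"
proof -
  have "(\<Prod>j<p + 1. a (c l) - a (j + 1)) = 0" for l
  proof -
    have "c l \<in> {1..p + 1}" using r by blast
    then have "c l - 1 < p + 1" "c l - 1 + 1 = c l" by auto
    then show ?thesis by (intro prod_zero bexI[of _ "c l - 1"]) auto
  qed
  then have "mat_prod (\<lambda>j. diagm (a \<circ> c) - a (j + 1) *\<^sub>R mat 1) (p + 1) = 0"
    unfolding diagm_shift mat_prod_diagm by (simp add: vec_eq_iff diagm_nth del: prod.lessThan_Suc)
  then show ?thesis
    using m unfolding spectral_set_def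
    by (simp add: sym_mats_def transpose_diagm trace_power_diagm_colouring[OF r])
qed

lemma conj_in_spectral_set:
  assumes "orthogonal_matrix Q" and "X \<in> spectral_set p a m"
  shows "Q ** X ** transpose Q \<in> spectral_set p a m"
  using assms
  by (simp add: spectral_set_def sym_mats_def conj_shift mat_prod_conj mat_power_conj trace_conj
      matrix_transpose_mul matrix_mul_assoc del: mat_prod.simps)

definition eigenspace :: "real^'n^'n \<Rightarrow> real \<Rightarrow> (real^'n) set" where
  "eigenspace X t = {v. X *v v = t *\<^sub>R v}"

lemma subspace_eigenspace: "subspace (eigenspace X t)"
  by (simp add: eigenspace_def subspace_def matrix_vector_right_distrib scaleR_right_distrib
      matrix_vector_mult_scaleR)

lemma eigenspaces_orthogonal:
  assumes "X \<in> sym_mats" "s \<noteq> t" "x \<in> eigenspace X s" "y \<in> eigenspace X t"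
  shows "orthogonal x y"
proof -
  have "s * (x \<bullet> y) = (X *v x) \<bullet> y" using assms by (simp add: eigenspace_def)
  also have "\<dots> = x \<bullet> (X *v y)"
    using assms(1) vector_transpose_matrix[of x X] by (simp add: sym_mats_def flip: dot_lmul_matrix)
  also have "\<dots> = t * (x \<bullet> y)" using assms by (simp add: eigenspace_def)
  finally show ?thesis using assms(2) by (simp add: orthogonal_def)
qed

text \<open>
  Induction on the number of factors. Let \<open>L = X - a (m + 1) I\<close> be the last one. Since the \<open>a j\<close> are
  distinct, \<open>L\<close> acts on each of the first \<open>m\<close> eigenspaces as a nonzero scalar, and so maps their span
  onto itself. If \<open>L v\<close> lies in this span, it is therefore \<open>L u\<close> for some \<open>u\<close> in the span, and \<open>v - u\<close> is
  an eigenvector for \<open>a (m + 1)\<close>.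
\<close>

lemma mat_prod_kernel:
  assumes "inj_on a {1..m}" and "mat_prod (\<lambda>j. X - a (j + 1) *\<^sub>R mat 1) m *v v = 0"
  shows "v \<in> span (\<Union>j\<in>{1..m}. eigenspace X (a j))"
  using assms
proof (induction m arbitrary: v)
  case 0
  then show ?case by simp
next
  case (Suc m)
  let ?S = "\<Union>j\<in>{1..m}. eigenspace X (a j)"
  let ?L = "X - a (Suc m) *\<^sub>R mat 1"
  have "?L *v v \<in> span ?S"
    using Suc by (intro Suc.IH) (auto simp: matrix_vector_mul_assoc inj_on_def)
  moreover have "w \<in> (*v) ?L ` span ?S" if "w \<in> span ?S" for w
    using that
  proof (induction rule: span_induct_alt)
    case base
    then show ?case by (metis imageI matrix_vector_mult_0_right span_0)
  next
    case (step t x y)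
    then obtain j u where j: "j \<in> {1..m}" "X *v x = a j *\<^sub>R x" and u: "u \<in> span ?S" "y = ?L *v u"
      by (auto simp: eigenspace_def)
    have ne: "a j - a (Suc m) \<noteq> 0"
      using inj_onD[OF Suc.prems(1), of j "Suc m"] j(1) by auto
    define u' where "u' = (t / (a j - a (Suc m))) *\<^sub>R x + u"
    have "?L *v x = (a j - a (Suc m)) *\<^sub>R x"
      using j(2) by (simp add: matrix_vector_mult_diff_rdistrib scaleR_left_diff_distrib
          flip: scaleR_matrix_vector_assoc)
    then have "?L *v u' = t *\<^sub>R x + y"
      using ne by (simp add: u'_def u(2) matrix_vector_right_distrib matrix_vector_mult_scaleR)
    moreover have "u' \<in> span ?S"
      unfolding u'_def using step(1) u(1) by (intro span_add span_scale) (auto intro: span_base)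
    ultimately show ?case by (metis imageI)
  qed
  ultimately obtain u where u: "u \<in> span ?S" "?L *v v = ?L *v u" by blast
  have "?L *v (v - u) = 0" using u(2) by (simp add: matrix_vector_mult_diff_distrib)
  then have "v - u \<in> eigenspace X (a (Suc m))"
    by (simp add: eigenspace_def matrix_vector_mult_diff_rdistrib flip: scaleR_matrix_vector_assoc)
  then have "v - u \<in> span (\<Union>j\<in>{1..Suc m}. eigenspace X (a j))"
    by (intro span_base) auto
  moreover have "u \<in> span (\<Union>j\<in>{1..Suc m}. eigenspace X (a j))"
    using u(1) span_mono[of ?S "\<Union>j\<in>{1..Suc m}. eigenspace X (a j)"] by fastforce
  ultimately show ?case
    using span_add by fastforce
qed

lemma sum_dim_orthogonal_subspaces:
  fixes V :: "'j \<Rightarrow> 'a::euclidean_space set"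
  assumes fin: "finite J" and sub: "\<And>j. j \<in> J \<Longrightarrow> subspace (V j)"
    and orth: "\<And>i j x y. i \<in> J \<Longrightarrow> j \<in> J \<Longrightarrow> i \<noteq> j \<Longrightarrow> x \<in> V i \<Longrightarrow> y \<in> V j \<Longrightarrow> orthogonal x y"
    and sp: "span (\<Union>j\<in>J. V j) = UNIV"
  shows "(\<Sum>j\<in>J. dim (V j)) = DIM('a)"
proof -
  have "\<exists>B. B \<subseteq> V j \<and> pairwise orthogonal B \<and> (\<forall>x\<in>B. norm x = 1) \<and> card B = dim (V j) \<and> span B = V j"
    if "j \<in> J" for j
    using orthonormal_basis_subspace[OF sub[OF that]] by metis
  then obtain B where B: "\<And>j. j \<in> J \<Longrightarrow> B j \<subseteq> V j" "\<And>j. j \<in> J \<Longrightarrow> pairwise orthogonal (B j)"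
    "\<And>j x. j \<in> J \<Longrightarrow> x \<in> B j \<Longrightarrow> norm x = 1" "\<And>j. j \<in> J \<Longrightarrow> card (B j) = dim (V j)"
    "\<And>j. j \<in> J \<Longrightarrow> span (B j) = V j"
    by metis
  let ?B = "\<Union>j\<in>J. B j"
  have po: "pairwise orthogonal ?B"
  proof (rule pairwiseI)
    fix x y assume "x \<in> ?B" "y \<in> ?B" "x \<noteq> y"
    then obtain i j where "i \<in> J" "j \<in> J" "x \<in> B i" "y \<in> B j" by blast
    then show "orthogonal x y"
      using B(1,2) orth[of i j x y] \<open>x \<noteq> y\<close> by (cases "i = j") (auto simp: pairwise_def)
  qed
  moreover have "0 \<notin> ?B" using B(3) by force
  ultimately have ind: "independent ?B" by (rule pairwise_orthogonal_independent)
  have "V j \<subseteq> span ?B" if "j \<in> J" for j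
    using B(5)[OF that] that by (metis UN_upper span_mono)
  then have "span (\<Union>j\<in>J. V j) \<subseteq> span ?B"
    by (intro span_minimal) auto
  then have "dim (UNIV :: 'a set) = card ?B"
    using sp by (intro dim_eq_card[OF _ ind]) auto
  moreover have "card ?B = (\<Sum>j\<in>J. card (B j))"
  proof (rule card_UN_disjoint[OF fin])
    have "finite ?B" using ind independent_imp_finite by blast
    then show "\<forall>j\<in>J. finite (B j)" by (meson UN_upper finite_subset)
    show "\<forall>i\<in>J. \<forall>j\<in>J. i \<noteq> j \<longrightarrow> B i \<inter> B j = {}"
    proof (intro ballI impI)
      fix i j assume ij: "i \<in> J" "j \<in> J" "i \<noteq> j"
      have "False" if "x \<in> B i" "x \<in> B j" for x
      proof -
        have "x = 0" using orth[OF ij, of x x] B(1)[OF ij(1)] B(1)[OF ij(2)] that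
          by (auto simp: orthogonal_self)
        then show False using B(3)[OF ij(1) that(1)] by simp
      qed
      then show "B i \<inter> B j = {}" by blast
    qed
  qed
  ultimately show ?thesis using B(4) by simp
qed

lemma diagonalise_by_eigenvectors:
  assumes Q: "orthogonal_matrix Q" and col: "\<And>l. column l Q \<in> eigenspace X (d l)"
  shows "X = Q ** diagm d ** transpose Q"
proof -
  have "(X ** Q) $ r $ l = (Q ** diagm d) $ r $ l" for r l
  proof -
    have "(X ** Q) $ r $ l = (X *v column l Q) $ r"
      by (simp add: matrix_matrix_mult_def matrix_vector_mult_def column_def)
    also have "\<dots> = d l * Q $ r $ l"
      using col[of l] by (simp add: eigenspace_def column_def)
    finally show ?thesis by (simp add: diagm_mult_right mult.commute)
  qed
  then show ?thesis
    unfolding conj_eq_iff[OF Q] by (simp add: vec_eq_iff)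
qed

text \<open>
  The annihilating polynomial makes \<open>X\<close> diagonalisable with eigenvalues among the \<open>a j\<close>, in an
  orthonormal basis because \<open>X\<close> is symmetric. The dimensions of the eigenspaces are then
  weights with the same power sums of order \<open>0, \<dots>, p\<close> as the \<open>m j\<close>, and therefore equal the
  \<open>m j\<close>.
\<close>

lemma spectral_set_diagonalisable:
  fixes X :: "real^'n^'n"
  assumes X: "X \<in> spectral_set p a m" and inj: "inj_on a {1..p + 1}"
    and r: "range c \<subseteq> {1..p + 1}" and m: "\<And>j. j \<in> {1..p + 1} \<Longrightarrow> card {l. c l = j} = m j"
  obtains Q where "rotation_matrix Q" and "X = Q ** diagm (a \<circ> c) ** transpose Q"
proof -
  let ?J = "{1..p + 1}"
  define E where "E j = eigenspace X (a j)" for j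
  have sym: "X \<in> sym_mats" and ann: "mat_prod (\<lambda>j. X - a (j + 1) *\<^sub>R mat 1) (p + 1) = 0"
    and tr: "\<And>i. i \<in> {1..p} \<Longrightarrow>
      trace (mat_power X i) = (\<Sum>j=0..p. real (m (j + 1)) * a (j + 1) ^ i)"
    using X by (auto simp: spectral_set_def)
  have sub: "subspace (E j)" for j by (simp add: E_def subspace_eigenspace)
  have orth: "orthogonal x y" if "i \<in> ?J" "j \<in> ?J" "i \<noteq> j" "x \<in> E i" "y \<in> E j" for i j x y
    using that inj_onD[OF inj, of i j] unfolding E_def
    by (intro eigenspaces_orthogonal[OF sym, of "a i" "a j"]) auto
  have diag: "\<exists>Q. rotation_matrix Q \<and> X = Q ** diagm (a \<circ> c') ** transpose Q"
    if r': "range c' \<subseteq> ?J" and d': "\<And>l. dim (E (c' l)) = card {l'. c' l' = c' l}" for c' :: "'n \<Rightarrow> nat"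
  proof -
    obtain Q where Q: "rotation_matrix Q" "\<And>l. column l Q \<in> E (c' l)"
    proof (rule adapted_rotation[of E c'])
      show "orthogonal x y" if "c' l \<noteq> c' l'" "x \<in> E (c' l)" "y \<in> E (c' l')" for l l' x y
        using orth that r' by (meson rangeI subsetD)
    qed (use sub d' in auto)
    then have "X = Q ** diagm (a \<circ> c') ** transpose Q"
      by (intro diagonalise_by_eigenvectors rotation_orthogonal) (auto simp: E_def)
    then show ?thesis using Q(1) by blast
  qed
  have "v \<in> span (\<Union>j\<in>?J. E j)" for v
    unfolding E_def by (rule mat_prod_kernel[OF inj]) (simp only: ann matrix_vector_mult_0)
  then have "span (\<Union>j\<in>?J. E j) = UNIV" by blast
  then have "(\<Sum>j\<in>?J. dim (E j)) = CARD('n)"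
    using sum_dim_orthogonal_subspaces[of ?J E] sub orth by simp
  \<comment> \<open>A first diagonalisation, with the unknown dimensions as block sizes, gives access to traces.\<close>
  from colouring_exists[OF finite_atLeastAtMost this]
  obtain c' :: "'n \<Rightarrow> nat" where c': "range c' \<subseteq> ?J" "\<And>j. j \<in> ?J \<Longrightarrow> card {l. c' l = j} = dim (E j)"
    by blast
  have "dim (E (c' l)) = card {l'. c' l' = c' l}" for l
    using c' by (metis rangeI subsetD)
  then obtain Q' where Q': "rotation_matrix Q'" "X = Q' ** diagm (a \<circ> c') ** transpose Q'"
    using diag[OF c'(1)] by blast
  have "real (card {l. c' l = j}) - real (m j) = 0" if "j \<in> ?J" for j
  proof (rule power_sums_determine_weights[of ?J a "\<lambda>j. real (card {l. c' l = j}) - real (m j)",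
        OF _ inj _ that])
    fix i assume "i < card ?J"
    let ?s = "\<lambda>f. \<Sum>j=0..p. real (f (j + 1)) * a (j + 1) ^ i"
    \<comment> \<open>Order \<open>0\<close> is the size of the matrix, counted through both colourings.\<close>
    have "?s (\<lambda>j. card {l. c' l = j}) = ?s m"
    proof (cases "i = 0")
      case True
      have "(\<Sum>j\<in>?J. card {l. c' l = j}) = (\<Sum>j\<in>?J. m j)"
        using sum_colouring[OF finite_atLeastAtMost c'(1), of "\<lambda>_. 1 :: nat"]
          sum_colouring[OF finite_atLeastAtMost r, of "\<lambda>_. 1 :: nat"] m
        by simp
      then have "(\<Sum>j=0..p. card {l. c' l = j + 1}) = (\<Sum>j=0..p. m (j + 1))"
        using sum.shift_bounds_cl_nat_ivl[of "\<lambda>j. card {l. c' l = j}" 0 1 p]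
          sum.shift_bounds_cl_nat_ivl[of m 0 1 p] by simp
      then have "real (\<Sum>j=0..p. card {l. c' l = j + 1}) = real (\<Sum>j=0..p. m (j + 1))"
        by (rule arg_cong)
      then show ?thesis using True by simp
    next
      case False
      then have "i \<in> {1..p}" using \<open>i < card ?J\<close> by simp
      then have "?s m = trace (mat_power X i)" using tr by simp
      also have "\<dots> = trace (mat_power (diagm (a \<circ> c')) i)"
        using Q' by (simp add: mat_power_conj rotation_orthogonal trace_conj)
      finally show ?thesis using trace_power_diagm_colouring[OF c'(1)] by simp
    qed
    then have "(\<Sum>j=0..p. (real (card {l. c' l = j + 1}) - real (m (j + 1))) * a (j + 1) ^ i) = 0"
      by (simp add: left_diff_distrib sum_subtractf)
    then show "(\<Sum>j\<in>?J. (real (card {l. c' l = j}) - real (m j)) * a j ^ i) = 0"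
      using sum.shift_bounds_cl_nat_ivl[of "\<lambda>j. (real (card {l. c' l = j}) - real (m j)) * a j ^ i" 0 1 p]
      by simp
  qed simp
  then have "card {l. c' l = j} = m j" if "j \<in> ?J" for j using that by fastforce
  then have "dim (E (c l)) = card {l'. c l' = c l}" for l
    using c'(2) m r by (metis rangeI subsetD)
  then show ?thesis using diag[OF r] that by blast
qed

lemma spectral_set_eq_orbit:
  fixes X0 :: "real^'n^'n"
  assumes X0: "X0 \<in> spectral_set p a m" and inj: "inj_on a {1..p + 1}"
    and r: "range c \<subseteq> {1..p + 1}" and m: "\<And>j. j \<in> {1..p + 1} \<Longrightarrow> card {l :: 'n. c l = j} = m j"
  shows "spectral_set p a m = {Q ** X0 ** transpose Q | Q. rotation_matrix Q}"
proof (intro equalityI subsetI)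
  fix X :: "real^'n^'n" assume "X \<in> spectral_set p a m"
  then obtain Q :: "real^'n^'n" where Q: "rotation_matrix Q" "X = Q ** diagm (a \<circ> c) ** transpose Q"
    using spectral_set_diagonalisable[OF _ inj r m] by blast
  obtain R where R: "rotation_matrix R" "X0 = R ** diagm (a \<circ> c) ** transpose R"
    using spectral_set_diagonalisable[OF X0 inj r m] by blast
  have "(Q ** transpose R) ** X0 ** transpose (Q ** transpose R)
      = Q ** (transpose R ** R) ** diagm (a \<circ> c) ** (transpose R ** R) ** transpose Q"
    unfolding R(2) by (simp add: matrix_transpose_mul matrix_mul_assoc)
  also have "\<dots> = X"
    using rotation_orthogonal[OF R(1)] by (simp add: Q(2) orthogonal_matrix_def)
  finally show "X \<in> {Q ** X0 ** transpose Q | Q. rotation_matrix Q}"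
    using rotation_matrix_mul[OF Q(1) rotation_matrix_transpose[OF R(1)]]
    by (metis (mono_tags, lifting) mem_Collect_eq)
next
  fix X :: "real^'n^'n" assume "X \<in> {Q ** X0 ** transpose Q | Q. rotation_matrix Q}"
  then show "X \<in> spectral_set p a m"
    using conj_in_spectral_set[OF rotation_orthogonal X0] by blast
qed

section \<open>The image of the standard flag\<close>

text \<open>
  This constrains the image of a flag through the stabiliser of the flag. For the standard flag
  it is evaluated below at sign matrices and at signed transpositions.
\<close>

lemma equivariant_fixed:
  assumes "equivariant p k \<epsilon>" and "W \<in> Flag p k" and "rotation_matrix Q" and "flag_act Q W = W"
  shows "\<epsilon> W ** Q = Q ** \<epsilon> W"
  using assms conj_eq_iff[OF rotation_orthogonal, of Q "\<epsilon> W" "\<epsilon> W"]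
  unfolding equivariant_def by metis

lemma rotation_fixes_std_flag:
  assumes std: "std_flag c \<in> Flag p k" and Q: "rotation_matrix Q"
    and supp: "\<And>r l. Q $ r $ l \<noteq> 0 \<Longrightarrow> c r = c l"
  shows "flag_act Q (std_flag c) = std_flag c"
proof (rule Flag_eqI)
  show "flag_act Q (std_flag c) \<in> Flag p k"
    by (intro flag_act_in_Flag std orthogonal_matrix_inj rotation_orthogonal Q)
  have "(Q *v x) $ r = 0" if "x \<in> std_flag c i" "i < c r" for x i r
  proof -
    have "Q $ r $ l * x $ l = 0" for l
      using that supp[of r l] by (cases "Q $ r $ l = 0") (auto simp: std_flag_def)
    then show ?thesis by (simp only: matrix_vector_mult_def vec_lambda_beta sum.neutral_const)
  qed
  then show "flag_act Q (std_flag c) i \<subseteq> std_flag c i" for i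
    by (auto simp: flag_act_def std_flag_def)
qed (rule std)

text \<open>
  To kill the entry at \<open>i, j\<close> one needs a diagonal sign matrix of determinant \<open>1\<close> with different
  signs at \<open>i\<close> and \<open>j\<close>. This requires a third index to absorb the second minus sign: in the plane
  only \<open>I\<close> and \<open>- I\<close> are available, and the image can fail to be diagonal.
\<close>

lemma diagonal_of_card_ge_3:
  fixes \<epsilon> :: "(nat \<Rightarrow> (real^'n) set) \<Rightarrow> real^'n^'n"
  assumes eq: "equivariant p k \<epsilon>" and std: "std_flag c \<in> Flag p k" and n: "CARD('n) \<ge> 3"
  shows "\<epsilon> (std_flag c) = diagm (\<lambda>l. \<epsilon> (std_flag c) $ l $ l)"
proof -
  have "\<epsilon> (std_flag c) $ i $ j = 0" if "i \<noteq> j" for i j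
  proof -
    have "\<not> UNIV \<subseteq> {i, j}"
      using card_mono[of "{i, j}" UNIV] n \<open>i \<noteq> j\<close> by auto
    then obtain l where l: "l \<noteq> i" "l \<noteq> j" by blast
    define s where "s r = (if r \<in> {i, l} then -1 else 1 :: real)" for r
    have "(\<Prod>r\<in>UNIV. s r) = (\<Prod>r\<in>{i, l}. -1)"
      by (rule prod.mono_neutral_cong_right) (auto simp: s_def)
    then have "(\<Prod>r\<in>UNIV. s r) = 1" using l by simp
    then have "rotation_matrix (diagm s)"
      by (intro rotation_matrix_diagm_signs) (simp_all add: s_def)
    moreover from this have "flag_act (diagm s) (std_flag c) = std_flag c"
      by (intro rotation_fixes_std_flag[OF std]) (auto simp: diagm_nth split: if_splits)
    ultimately have "\<epsilon> (std_flag c) ** diagm s = diagm s ** \<epsilon> (std_flag c)"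
      by (rule equivariant_fixed[OF eq std])
    then have "(\<epsilon> (std_flag c) ** diagm s) $ i $ j = (diagm s ** \<epsilon> (std_flag c)) $ i $ j"
      by simp
    then show ?thesis
      using l \<open>i \<noteq> j\<close> by (simp add: diagm_mult_left diagm_mult_right s_def)
  qed
  then show ?thesis by (simp add: vec_eq_iff diagm_nth)
qed

text \<open>
  Exchanging two coordinates of the same block fixes the standard flag.
\<close>

lemma equal_entries_of_same_colour:
  assumes eq: "equivariant p k \<epsilon>" and std: "std_flag c \<in> Flag p k"
    and d: "\<epsilon> (std_flag c) = diagm d" and ij: "c i = c j"
  shows "d i = d j"
proof -
  let ?\<pi> = "Transposition.transpose i j"
  obtain Q :: "real^'a^'a" and s where Q: "rotation_matrix Q" "\<And>l. s l \<noteq> 0"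
    "Q = (\<chi> r l. if r = ?\<pi> l then s l else 0)"
    by (rule rotation_signed_transposition[of i j]) (rule that)
  have "c (?\<pi> l) = c l" for l
    using ij by (simp add: Transposition.transpose_def)
  then have "flag_act Q (std_flag c) = std_flag c"
    by (intro rotation_fixes_std_flag[OF std Q(1)]) (auto simp: Q(3) split: if_splits)
  then have "diagm d ** Q = Q ** diagm d"
    using equivariant_fixed[OF eq std Q(1)] d by simp
  then have "(diagm d ** Q) $ j $ i = (Q ** diagm d) $ j $ i" by simp
  then show ?thesis
    using Q(2)[of i] by (simp add: diagm_mult_left diagm_mult_right Q(3))
qed

text \<open>
  If the entries at \<open>i\<close> and \<open>j\<close> agree, then exchanging these coordinates fixes the image of the
  standard flag, hence by injectivity the flag itself; but an exchange between different blocks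
  moves the flag.
\<close>

lemma same_colour_of_equal_entries:
  assumes eq: "equivariant p k \<epsilon>" and inj: "inj_on \<epsilon> (Flag p k)" and std: "std_flag c \<in> Flag p k"
    and d: "\<epsilon> (std_flag c) = diagm d" and "d i = d j"
  shows "c i = c j"
proof -
  have "\<not> c i < c j" if dij: "d i = d j" for i j
  proof
    assume less: "c i < c j"
    let ?\<pi> = "Transposition.transpose i j"
    obtain Q :: "real^'a^'a" and s where Q: "rotation_matrix Q" "\<And>l. s l \<noteq> 0"
      "Q = (\<chi> r l. if r = ?\<pi> l then s l else 0)"
      by (rule rotation_signed_transposition[of i j]) (rule that)
    have "d (?\<pi> l) = d l" for l
      using dij by (simp add: Transposition.transpose_def)
    then have "diagm d ** Q = Q ** diagm d"
      by (auto simp: vec_eq_iff diagm_mult_left diagm_mult_right Q(3))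
    then have "\<epsilon> (flag_act Q (std_flag c)) = \<epsilon> (std_flag c)"
      using eq std Q(1) d conj_eq_iff[OF rotation_orthogonal[OF Q(1)], of "diagm d" "diagm d"]
      by (simp add: equivariant_def)
    moreover have "flag_act Q (std_flag c) \<in> Flag p k"
      by (intro flag_act_in_Flag std orthogonal_matrix_inj rotation_orthogonal Q)
    ultimately have fixd: "flag_act Q (std_flag c) = std_flag c"
      using inj std by (simp add: inj_on_eq_iff)
    have "axis i 1 \<in> std_flag c (c i)"
      by (auto simp: std_flag_def axis_def)
    then have "Q *v axis i 1 \<in> std_flag c (c i)"
      using fun_cong[OF fixd, of "c i"] by (auto simp: flag_act_def)
    then have "Q $ j $ i = 0"
      using less by (simp add: std_flag_def matrix_vector_mult_basis column_def)
    then show False using Q(2)[of i] by (simp add: Q(3))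
  qed
  from this[of i j] this[of j i] show ?thesis using \<open>d i = d j\<close> by simp
qed

text \<open>
  In the plane the image of the standard flag need not be diagonal, so its eigenvalues are
  taken from the quadratic formula. For diagonal entries \<open>x\<close>, \<open>z\<close> and off-diagonal entry \<open>y\<close> the
  discriminant of the characteristic polynomial is \<open>(x - z)\<^sup>2 + 4 * y\<^sup>2\<close>, which vanishes only for
  scalar matrices.
\<close>

lemma symmetric_2x2_spectrum:
  fixes X :: "real^'n^'n"
  assumes n: "CARD('n) = 2" and sym: "X \<in> sym_mats" and ns: "\<And>t. X \<noteq> diagm (\<lambda>_. t)"
  obtains s t where "s \<noteq> t" and "(X - s *\<^sub>R mat 1) ** (X - t *\<^sub>R mat 1) = 0" and "trace X = s + t"
proof -
  obtain i j :: 'n where ij: "UNIV = {i, j}" "i \<noteq> j"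
    using n by (metis card_2_iff)
  have all: "(\<forall>r. P r) \<longleftrightarrow> P i \<and> P j" for P :: "'n \<Rightarrow> bool"
    using ij(1) by (metis UNIV_I insertE singletonD)
  have sum: "(\<Sum>r\<in>UNIV. f r) = f i + f j" for f :: "'n \<Rightarrow> real"
    by (subst ij(1)) (simp add: ij(2))
  define x y z where "x = X $ i $ i" and "y = X $ i $ j" and "z = X $ j $ j"
  have y': "X $ j $ i = y"
    using sym unfolding sym_mats_def y_def
    by (metis (mono_tags, lifting) mem_Collect_eq transpose_def vec_lambda_beta)
  define D where "D = (x - z)\<^sup>2 + 4 * y\<^sup>2"
  have "D \<noteq> 0"
  proof
    assume "D = 0"
    then have "x = z" "y = 0" by (simp_all add: D_def add_nonneg_eq_0_iff)
    then have "X = diagm (\<lambda>_. x)"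
      using ij(2) y' by (simp add: vec_eq_iff all diagm_nth x_def y_def z_def)
    then show False using ns by blast
  qed
  moreover have "D \<ge> 0" by (simp add: D_def)
  ultimately have "D > 0" by simp
  define s where "s = (x + z + sqrt D) / 2"
  define t where "t = (x + z - sqrt D) / 2"
  have st: "s + t = x + z" by (simp add: s_def t_def field_simps)
  have "s * t = ((x + z)\<^sup>2 - (sqrt D)\<^sup>2) / 4"
    by (simp add: s_def t_def power2_eq_square algebra_simps)
  also have "\<dots> = x * z - y\<^sup>2"
    using \<open>D \<ge> 0\<close> by (simp add: D_def power2_eq_square field_simps)
  finally have prod: "s * t = x * z - y\<^sup>2" .
  show ?thesis
  proof
    show "s \<noteq> t" using \<open>D > 0\<close> by (simp add: s_def t_def)
    show "trace X = s + t"
      using st by (simp add: trace_def sum x_def z_def)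
    have z: "z = s + t - x" using st by simp
    have p: "s * t = x * (s + t - x) - y * y" using prod z by (simp add: power2_eq_square)
    have "(x - s) * (x - t) + y * y = 0" "y * (z - s) + (x - t) * y = 0" "(x - s) * y + y * (z - t) = 0"
      "y * (x - t) + (z - s) * y = 0"  "y * y + (z - s) * (z - t) = 0"
      using p unfolding z by (simp_all add: algebra_simps)
    then show "(X - s *\<^sub>R mat 1) ** (X - t *\<^sub>R mat 1) = 0"
      using ij(2) y'
      by (simp add: vec_eq_iff all matrix_matrix_mult_def sum mat_def x_def[symmetric] y_def[symmetric]
          z_def[symmetric] algebra_simps)
  qed
qed

text \<open>
  For \<open>n \<ge> 3\<close> the image is diagonal, constant on each block and with different values on different
  blocks. The remaining case is \<open>n = 2\<close>, where \<open>p = 1\<close> and both multiplicities are \<open>1\<close>: here the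
  eigenvalues differ because a scalar image would contradict injectivity.
\<close>

lemma spectral_set_of_std_flag:
  fixes p :: nat and k :: "nat \<Rightarrow> nat"
    and \<epsilon> :: "(nat \<Rightarrow> (real^'n) set) \<Rightarrow> real^'n^'n"
  assumes p: "p \<ge> 1" and k0: "k 0 = 0" and strict: "\<And>i. i \<le> p \<Longrightarrow> k i < k (i + 1)"
    and kn: "k (p + 1) = CARD('n)" and c: "flag_colouring p k c"
    and sym: "\<epsilon> (std_flag c) \<in> sym_mats" and inj: "inj_on \<epsilon> (Flag p k)"
    and eq: "equivariant p k \<epsilon>"
  obtains a where "inj_on a {1..p + 1}"
    and "\<epsilon> (std_flag c) \<in> spectral_set p a (\<lambda>j. k j - k (j - 1))"
proof -
  have std: "std_flag c \<in> Flag p k"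
    using strict by (intro std_flag_in_Flag[OF c k0]) (simp add: less_imp_le)
  have card: "card {l. c l = j} = k j - k (j - 1)" if "j \<in> {1..p + 1}" for j
    using c that by (simp add: flag_colouring_def)
  have onto: "\<exists>l. c l = j" if "j \<in> {1..p + 1}" for j
  proof -
    have "0 < k j - k (j - 1)" using that strict[of "j - 1"] by auto
    then have "{l. c l = j} \<noteq> {}" using card[OF that] by (metis card.empty less_irrefl)
    then show ?thesis by blast
  qed
  \<comment> \<open>At \<open>i = p + 1\<close> this bounds \<open>p\<close>, so that the plane leaves only \<open>p = 1\<close>.\<close>
  have ge: "i \<le> k i" if "i \<le> p + 1" for i
    using that
  proof (induction i)
    case (Suc i)
    then show ?case using strict[of i] by simp
  qed simp
  show ?thesis
  proof (cases "CARD('n) \<ge> 3")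
    case True
    then obtain d where d: "\<epsilon> (std_flag c) = diagm d"
      using diagonal_of_card_ge_3[OF eq std] by blast
    define a where "a j = d (SOME l. c l = j)" for j
    have a: "a (c l) = d l" for l
    proof -
      have "c (SOME l'. c l' = c l) = c l" by (rule someI) (rule refl)
      then show ?thesis
        unfolding a_def by (rule equal_entries_of_same_colour[OF eq std d])
    qed
    show ?thesis
    proof
      show "inj_on a {1..p + 1}"
      proof (rule inj_onI)
        fix i j assume "i \<in> {1..p + 1}" "j \<in> {1..p + 1}" and aij: "a i = a j"
        then obtain l l' where "c l = i" "c l' = j" using onto by blast
        then show "i = j"
          using aij a same_colour_of_equal_entries[OF eq inj std d, of l l'] by metis
      qed
      have "diagm d = diagm (a \<circ> c)" using a by (simp add: comp_def)
      then show "\<epsilon> (std_flag c) \<in> spectral_set p a (\<lambda>j. k j - k (j - 1))"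
        unfolding d using c diagm_in_spectral_set[of c p "\<lambda>j. k j - k (j - 1)" a]
        by (simp add: flag_colouring_def)
    qed
  next
    case False
    then have n: "CARD('n) = 2" and p1: "p = 1" using ge[of "p + 1"] kn p by simp_all
    have k: "k 1 = 1" "k 2 = 2" using strict[of 0] strict[of 1] k0 kn n p1
      by (simp_all add: numeral_2_eq_2)
    have "\<epsilon> (std_flag c) \<noteq> diagm (\<lambda>_. t)" for t
    proof
      assume scalar: "\<epsilon> (std_flag c) = diagm (\<lambda>_. t)"
      obtain l l' where "c l = 1" "c l' = 2" using onto p1 by fastforce
      then show False
        using same_colour_of_equal_entries[OF eq inj std scalar, of l l'] by simp
    qed
    then obtain s t where st: "s \<noteq> t" "trace (\<epsilon> (std_flag c)) = s + t"
      "(\<epsilon> (std_flag c) - s *\<^sub>R mat 1) ** (\<epsilon> (std_flag c) - t *\<^sub>R mat 1) = 0"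
      using symmetric_2x2_spectrum[OF n sym] by metis
    show ?thesis
    proof
      let ?a = "\<lambda>j :: nat. if j = 1 then s else t"
      show "inj_on ?a {1..p + 1}" using st(1) p1 by (auto simp: inj_on_def)
      show "\<epsilon> (std_flag c) \<in> spectral_set p ?a (\<lambda>j. k j - k (j - 1))"
        using st(2,3) sym p1 k k0 by (simp add: spectral_set_def numeral_2_eq_2)
    qed
  qed
qed

theorem theorem4p1:
  fixes p :: nat and k :: "nat \<Rightarrow> nat"
    and \<epsilon> :: "(nat \<Rightarrow> (real^'n) set) \<Rightarrow> real^'n^'n"
  assumes "p \<ge> 1"
    and "k 0 = 0" and "\<And>i. i \<le> p \<Longrightarrow> k i < k (i + 1)" and "k (p + 1) = CARD('n)"
    and "\<epsilon> \<in> Flag p k \<rightarrow> sym_mats"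
    and "smooth_embedding (flag_atlas p k) \<epsilon>"
    and "equivariant p k \<epsilon>"
  shows "\<exists>a :: nat \<Rightarrow> real. inj_on a {1..p + 1} \<and>
    \<epsilon> ` Flag p k =
      {X \<in> sym_mats.
         mat_prod (\<lambda>j. X - a (j + 1) *\<^sub>R mat 1) (p + 1) = 0 \<and>
         (\<forall>i\<in>{1..p}. trace (mat_power X i) =
            (\<Sum>j=0..p. real (k (j + 1) - k j) * a (j + 1) ^ i))}"
proof -
  have mono: "k i \<le> k (i + 1)" if "i \<le> p" for i using assms(3)[OF that] by simp
  obtain c :: "'n \<Rightarrow> nat" where c: "flag_colouring p k c"
    using flag_colouring_exists[OF assms(2) mono assms(4)] by blast
  have std: "std_flag c \<in> Flag p k" by (rule std_flag_in_Flag[OF c assms(2) mono])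
  have inj: "inj_on \<epsilon> (Flag p k)"
    using assms(6) homeomorphic_imp_injective_map
    unfolding smooth_embedding_def embedding_map_def by (metis topspace_flag_atlas)
  obtain a where a: "inj_on a {1..p + 1}"
    and spec: "\<epsilon> (std_flag c) \<in> spectral_set p a (\<lambda>j. k j - k (j - 1))"
    using spectral_set_of_std_flag[OF assms(1-4) c _ inj assms(7)] std assms(5) by blast
  have "\<epsilon> ` Flag p k = {Q ** \<epsilon> (std_flag c) ** transpose Q | Q. rotation_matrix Q}"
  proof (intro equalityI subsetI)
    fix X assume "X \<in> \<epsilon> ` Flag p k"
    then obtain W where W: "W \<in> Flag p k" "X = \<epsilon> W" by blast
    then obtain Q where "rotation_matrix Q" "flag_act Q (std_flag c) = W"
      using rotations_transitive_on_flags[OF W(1) c assms(2) mono assms(4)] by blast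
    then show "X \<in> {Q ** \<epsilon> (std_flag c) ** transpose Q | Q. rotation_matrix Q}"
      using assms(7) std W(2) unfolding equivariant_def by blast
  next
    fix X assume "X \<in> {Q ** \<epsilon> (std_flag c) ** transpose Q | Q. rotation_matrix Q}"
    then obtain Q where Q: "rotation_matrix Q" "X = \<epsilon> (flag_act Q (std_flag c))"
      using assms(7) std unfolding equivariant_def by auto
    then show "X \<in> \<epsilon> ` Flag p k"
      using flag_act_in_Flag[OF std orthogonal_matrix_inj[OF rotation_orthogonal[OF Q(1)]]] by blast
  qed
  also have "\<dots> = spectral_set p a (\<lambda>j. k j - k (j - 1))"
    using spectral_set_eq_orbit[OF spec a, of c] c by (simp add: flag_colouring_def)
  finally show ?thesis
    using a by (intro exI[of _ a]) (simp add: spectral_set_def)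
qed

end
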